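(* Let $r$ be the weak residual associated with a discrete primal solution $u_h$, and suppose that assumptions A1 (global decomposition), A2 (local decomposition) and A3 (polynomial representation) stated in the context hold, with local residuals $r_T$, cell residuals $R_T$ and facet residuals $R_{\partial T}$, so that $$r(v) = \sum_{T\in\mathcal{T}_h} \langle R_T, v\rangle_T + \langle R_{\partial T}, v\rangle_{\partial T} .$$ Then the cell and facet residuals of this representation are uniquely determined by the following local problems. For every $T\in\mathcal{T}_h$: (i) $R_T$ is the unique element of $\mathcal{P}^p(T)$ satisfying $$\langle R_T, b_T\phi_i\rangle_T = r_T(b_T\phi_i), \qquad i=1,\dots,m,$$ where $\{\phi_i\}_{i=1}^m$ is a basis of $\mathcal{P}^p(T)$ and $b_T$ is the bubble function on $T$; (ii) for every facet $S$ of $T$, with $R_T$ as in (i), $R_{\partial T}|_S$ is the unique element of $\mathcal{P}^q(S)$ satisfying $$\langle R_{\partial T}|_S, \beta_S^T\phi_i\rangle_S = r_T(\beta_S^T\phi_i) - \langle R_T, \beta_S^T\phi_i\rangle_T, \qquad i=1,\dots,n,$$ where $\{\phi_i\}_{i=1}^n$ is a basis of $\mathcal{P}^q(T)$ and $\beta_S^T$ is the cone function of $S$ on $T$. (If the test space is vector- or tensor-valued, the local problems are posed for each scalar component separately.)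
   Context: Setting. $\Omega\subset\mathbb{R}^d$, $d\in\{1,2,3\}$, is an open, bounded, polyhedral domain and $\mathcal{T}_h$ is an admissible (conforming) simplicial tessellation of $\Omega$. $V$ and $\hat V$ are Hilbert spaces of functions or (vector/tensor) fields on $\Omega$; $a: V\times\hat V\to\mathbb{R}$ is a continuous bilinear form and $L:\hat V\to\mathbb{R}$ a continuous linear form, and the problem of finding $u\in V$ with $a(u,v)=L(v)$ for all $v\in\hat V$ is well-posed. $V_h\subset V$ and $\hat V_h\subset\hat V$ are finite element spaces relative to $\mathcal{T}_h$, and $u_h\in V_h$ is the unique solution of $a(u_h,v)=L(v)$ for all $v\in\hat V_h$. The weak residual is $r(v)=L(v)-a(u_h,v)$ for $v \in \hat V$. Notation. $\langle\cdot,\cdot\rangle_K$ denotes the $L^2(K)$ inner product (summed over components for vector or tensor fields), for $K$ a cell $T$, a facet $S$ (with surface measure), or a cell boundary $\partial T$. $\mathcal{P}^k(K)$ denotes the (real-valued) polynomials of degree at most $k$ on $K$. $\hat V|_T$ denotes the restrictions to $T$ of elements of $\hat V$. The facets of a $d$-simplex $T$ are its $(d-1)$-dimensional faces. Assumptions. A1 (Global decomposition): the residual is a sum of local contributions, $r=\sum_{T\in\mathcal{T}_h} r_T$, where $r_T$ is a linear functional acting on restrictions $v|_T$. A2 (Local decomposition): for each $T\in\mathcal{T}_h$ there are $R_T$ on $T$ and $R_{\partial T}$ on $\partial T$ such that $r_T(v)=\langle R_T,v\rangle_T+\langle R_{\partial T},v\rangle_{\partial T}$ for all $v\in\hat V|_T$.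 The test functions $b_T\phi_i$ and $\beta_S^T\phi_i$ used in the local problems (placed in a single scalar component in the vector- or tensor-valued case) are understood to be among the admissible $v$ for which this identity holds. A3 (Polynomial representation): there are $p,q\in\mathbb{N}$ such that $R_T\in\mathcal{P}^p(T)$ and $R_{\partial T}|_S\in\mathcal{P}^q(S)$ for all facets $S$ of $T$ and all $T\in\mathcal{T}_h$ (in the vector- or tensor-valued case, each scalar component satisfies this). Bubble and cone functions. For a $d$-simplex $T$ with vertices $x_1,\dots,x_{d+1}$, let $\lambda_{x_i}^T$ be the barycentric coordinate function on $T$ associated with $x_i$. The bubble function is $b_T=\prod_{i=1}^{d+1}\lambda_{x_i}^T$; it vanishes on $\partial T$. For a facet $S$ of $T$, the cone function is $\beta_S^T=\prod_{i\in I_S^T}\lambda_{x_i}^T$, where $I_S^T$ is the set of indices of those vertices of $T$ that lie on $S$; thus $\beta_S^T$ vanishes on all facets of $T$ other than $S$, and $\beta_S^T|_S=b_S$, the bubble function of the simplex $S$. *)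

theory Defs
  imports "HOL-Analysis.Analysis"
begin

definition polyhedral_domain :: "'a::euclidean_space set \<Rightarrow> bool" where
  "polyhedral_domain \<Omega> \<longleftrightarrow>
     open \<Omega> \<and> connected \<Omega> \<and> \<Omega> \<noteq> {} \<and> bounded \<Omega> \<and>
     (\<exists>F. finite F \<and> (\<forall>P\<in>F. polytope P \<and> aff_dim P = int DIM('a) - 1) \<and> frontier \<Omega> = \<Union>F)"

text \<open>Cells are closed simplices; \<^const>\<open>triangulation\<close> is the conformity condition (two cells
  meet in a common face, possibly empty).\<close>

definition tessellation :: "'a::euclidean_space set \<Rightarrow> 'a set set \<Rightarrow> bool" where
  "tessellation \<Omega> \<T> \<longleftrightarrow>
     triangulation \<T> \<and> (\<forall>T\<in>\<T>. int DIM('a) simplex T) \<and> \<Union>\<T> = closure \<Omega>"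

text \<open>For a set \<open>S\<close> that spans a hyperplane, \<open>facet_prism S\<close> is the right prism of height one
  over \<open>S\<close>: the points \<open>x + y\<close> with \<open>x \<in> S\<close> and \<open>y\<close> in the segment of length one, centred
  at the origin, that is orthogonal to \<open>S\<close>. On this prism \<open>closest_point S\<close> is the orthogonal
  projection \<open>x + y \<mapsto> x\<close>. Since Lebesgue measure on the prism is the product of the surface
  measure of \<open>S\<close> and the length in normal direction, and the height is one, the image of
  Lebesgue measure under this projection is the \<open>(d-1)\<close>-dimensional surface measure of \<open>S\<close>.
  For \<open>d = 1\<close> it is the unit mass at the point \<open>S\<close>. All measures are completed, so
  that null sets and measurability have the usual meaning for \<open>L\<^sup>2\<close>.\<close>

definition facet_prism :: "'a::euclidean_space set \<Rightarrow> 'a set" where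
  "facet_prism S = {x + y |x y. x \<in> S \<and> (\<forall>a\<in>S. \<forall>b\<in>S. y \<bullet> (a - b) = 0) \<and> norm y \<le> 1 / 2}"

definition surface_measure :: "'a::euclidean_space set \<Rightarrow> 'a measure" where
  "surface_measure S =
     completion (distr (restrict_space lborel (facet_prism S)) borel (closest_point S))"

lemma closest_point_facet_prism:
  assumes "convex S" "closed S" "x \<in> S" "\<forall>a\<in>S. \<forall>b\<in>S. y \<bullet> (a - b) = 0"
  shows "closest_point S (x + y) = x"
proof (rule closest_point_unique[symmetric, OF assms(1-3)], intro ballI)
  fix z assume "z \<in> S"
  then have "y \<bullet> (x - z) = 0" using assms by blast
  then have "(norm (x + y - z))\<^sup>2 = (norm y)\<^sup>2 + (norm (x - z))\<^sup>2"
    unfolding power2_norm_eq_inner by (simp add: algebra_simps inner_commute)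
  then have "(norm y)\<^sup>2 \<le> (norm (x + y - z))\<^sup>2" by simp
  then have "norm y \<le> norm (x + y - z)" by (rule power2_le_imp_le) simp
  then show "dist (x + y) x \<le> dist (x + y) z" by (simp add: dist_norm)
qed

definition L2_inner :: "'a measure \<Rightarrow> ('a \<Rightarrow> 'b::euclidean_space) \<Rightarrow> ('a \<Rightarrow> 'b) \<Rightarrow> real" where
  "L2_inner M f g = (LINT x|M. f x \<bullet> g x)"

definition L2_field :: "'a measure \<Rightarrow> ('a \<Rightarrow> 'b::euclidean_space) \<Rightarrow> bool" where
  "L2_field M f \<longleftrightarrow> f \<in> borel_measurable M \<and> integrable M (\<lambda>x. (norm (f x))\<^sup>2)"

definition L2_inner_cell ::
  "'a::euclidean_space set \<Rightarrow> ('a \<Rightarrow> 'b::euclidean_space) \<Rightarrow> ('a \<Rightarrow> 'b) \<Rightarrow> real" where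
  "L2_inner_cell T f g = L2_inner (lebesgue_on T) f g"

definition L2_inner_facet ::
  "'a::euclidean_space set \<Rightarrow> ('a \<Rightarrow> 'b::euclidean_space) \<Rightarrow> ('a \<Rightarrow> 'b) \<Rightarrow> real" where
  "L2_inner_facet S f g = L2_inner (surface_measure S) f g"

text \<open>Two distinct facets overlap in a set of surface measure zero, hence the sum.\<close>

definition L2_inner_boundary ::
  "'a::euclidean_space set \<Rightarrow> ('a \<Rightarrow> 'b::euclidean_space) \<Rightarrow> ('a \<Rightarrow> 'b) \<Rightarrow> real" where
  "L2_inner_boundary T f g = (\<Sum>S\<in>{S. S facet_of T}. L2_inner_facet S f g)"

definition multi_indices :: "nat \<Rightarrow> ('a::euclidean_space \<Rightarrow> nat) set" where
  "multi_indices k = {\<alpha> \<in> Basis \<rightarrow>\<^sub>E UNIV. (\<Sum>b\<in>Basis. \<alpha> b) \<le> k}"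

lemma finite_multi_indices: "finite (multi_indices k :: ('a::euclidean_space \<Rightarrow> nat) set)"
proof (rule finite_subset)
  show "multi_indices k \<subseteq> ((Basis::'a set) \<rightarrow>\<^sub>E {..k})"
  proof
    fix \<alpha> :: "'a \<Rightarrow> nat" assume \<alpha>: "\<alpha> \<in> multi_indices k"
    have "\<alpha> b \<le> k" if "b \<in> Basis" for b
      using member_le_sum[OF that, of \<alpha>] \<alpha> by (force simp: multi_indices_def)
    then show "\<alpha> \<in> Basis \<rightarrow>\<^sub>E {..k}"
      using \<alpha> by (auto simp: multi_indices_def PiE_iff)
  qed
  show "finite ((Basis::'a set) \<rightarrow>\<^sub>E {..k})" by (intro finite_PiE) auto
qed

text \<open>\<open>\<P>\<^sup>k(K)\<close>: the restrictions to \<open>K\<close> (as extensional functions, so that equality means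
  equality on \<open>K\<close>) of the polynomial functions of total degree at most \<open>k\<close>.\<close>

definition poly_space :: "nat \<Rightarrow> 'a::euclidean_space set \<Rightarrow> ('a \<Rightarrow> real) set" where
  "poly_space k K =
     {restrict (\<lambda>x. \<Sum>\<alpha>\<in>multi_indices k. c \<alpha> * (\<Prod>b\<in>Basis. (x \<bullet> b) ^ \<alpha> b)) K |c. True}"

definition poly_basis :: "nat \<Rightarrow> 'a::euclidean_space set \<Rightarrow> nat \<Rightarrow> (nat \<Rightarrow> 'a \<Rightarrow> real) \<Rightarrow> bool" where
  "poly_basis k K m \<phi> \<longleftrightarrow>
     (\<forall>i\<in>{1..m}. \<phi> i \<in> poly_space k K) \<and>
     (\<forall>c :: nat \<Rightarrow> real. (\<forall>x\<in>K. (\<Sum>i=1..m. c i * \<phi> i x) = 0) \<longrightarrow> (\<forall>i\<in>{1..m}. c i = 0)) \<and>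
     (\<forall>f\<in>poly_space k K. \<exists>c :: nat \<Rightarrow> real. \<forall>x\<in>K. f x = (\<Sum>i=1..m. c i * \<phi> i x))"

text \<open>Membership in \<open>\<P>\<^sup>k(K)\<close> for the components of a field given only up to a null set of \<open>M\<close>.\<close>

definition poly_field :: "nat \<Rightarrow> 'a::euclidean_space set \<Rightarrow> 'a measure \<Rightarrow> ('a \<Rightarrow> 'b::euclidean_space) \<Rightarrow> bool"
  where
  "poly_field k K M f \<longleftrightarrow>
     (\<forall>e\<in>Basis. \<exists>g\<in>poly_space k K. AE x in M. f x \<bullet> e = g x)"

definition vertices :: "'a::euclidean_space set \<Rightarrow> 'a set" where
  "vertices T = {v. v extreme_point_of T}"

definition barycentric :: "'a::euclidean_space set \<Rightarrow> 'a \<Rightarrow> 'a \<Rightarrow> real" where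
  "barycentric T v x =
     (THE t. \<exists>u. (\<Sum>w\<in>vertices T. u w) = 1 \<and> (\<Sum>w\<in>vertices T. u w *\<^sub>R w) = x \<and> t = u v)"

definition bubble :: "'a::euclidean_space set \<Rightarrow> 'a \<Rightarrow> real" where
  "bubble T x = (\<Prod>v\<in>vertices T. barycentric T v x)"

definition cone_fun :: "'a::euclidean_space set \<Rightarrow> 'a set \<Rightarrow> 'a \<Rightarrow> real" where
  "cone_fun T S x = (\<Prod>v\<in>{v \<in> vertices T. v \<in> S}. barycentric T v x)"

text \<open>A Hilbert space of fields on \<open>\<Omega>\<close> is a real Hilbert space \<open>'v\<close> together with a map \<open>\<iota>\<close>
  that sends each element to a representative of the field that it is. Fields are identified if
  they agree almost everywhere, so \<open>\<iota>\<close> is linear and injective up to null sets. The components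
  of a field are those with respect to \<^const>\<open>Basis\<close> of \<open>'b\<close>; the scalar case is
  \<open>'b = real\<close>.\<close>

definition field_space ::
  "'a::euclidean_space set \<Rightarrow> ('v::{real_inner,complete_space} \<Rightarrow> 'a \<Rightarrow> 'b::euclidean_space) \<Rightarrow> bool"
  where
  "field_space \<Omega> \<iota> \<longleftrightarrow>
     (\<forall>v. \<iota> v \<in> borel_measurable (lebesgue_on \<Omega>)) \<and>
     (\<forall>v w. AE x in lebesgue_on \<Omega>. \<iota> (v + w) x = \<iota> v x + \<iota> w x) \<and>
     (\<forall>c v. AE x in lebesgue_on \<Omega>. \<iota> (c *\<^sub>R v) x = c *\<^sub>R \<iota> v x) \<and>
     (\<forall>v. (AE x in lebesgue_on \<Omega>. \<iota> v x = 0) \<longrightarrow> v = 0)"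

definition fe_space ::
  "'a::euclidean_space set set \<Rightarrow> ('v::real_vector \<Rightarrow> 'a \<Rightarrow> 'b::euclidean_space) \<Rightarrow> 'v set \<Rightarrow> bool"
  where
  "fe_space \<T> \<iota> W \<longleftrightarrow>
     (\<exists>B. finite B \<and> W = span B) \<and>
     (\<exists>k. \<forall>w\<in>W. \<forall>T\<in>\<T>. poly_field k T (lebesgue_on T) (\<iota> w))"

text \<open>Well-posedness in the sense of Hadamard: existence, uniqueness and continuous dependence on
  the right-hand side.\<close>

definition well_posed :: "('u::real_normed_vector \<Rightarrow> 'v::real_normed_vector \<Rightarrow> real) \<Rightarrow> bool" where
  "well_posed a \<longleftrightarrow>
     (\<forall>l. bounded_linear l \<longrightarrow> (\<exists>!u. \<forall>v. a u v = l v)) \<and>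
     (\<exists>C. \<forall>l u. bounded_linear l \<longrightarrow> (\<forall>v. a u v = l v) \<longrightarrow> norm u \<le> C * onorm l)"

definition discrete_solution ::
  "('u \<Rightarrow> 'v \<Rightarrow> real) \<Rightarrow> ('v \<Rightarrow> real) \<Rightarrow> 'u set \<Rightarrow> 'v set \<Rightarrow> 'u \<Rightarrow> bool" where
  "discrete_solution a L U W u \<longleftrightarrow> u \<in> U \<and> (\<forall>v\<in>W. a u v = L v)"

definition weak_residual :: "('u \<Rightarrow> 'v \<Rightarrow> real) \<Rightarrow> ('v \<Rightarrow> real) \<Rightarrow> 'u \<Rightarrow> 'v \<Rightarrow> real" where
  "weak_residual a L u v = L v - a u v"

text \<open>\<open>D\<close> is the space of admissible fields on the cell \<open>T\<close> (as extensional functions), on which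
  \<open>r\<^sub>T\<close> acts and the local decomposition is required. It contains the restrictions of all test
  functions, and possibly further fields (the bubble and cone test functions need not be
  restrictions of elements of the global test space).\<close>

definition admissible_space ::
  "'a::euclidean_space set \<Rightarrow> ('v \<Rightarrow> 'a \<Rightarrow> 'b::euclidean_space) \<Rightarrow> ('a \<Rightarrow> 'b) set \<Rightarrow> bool" where
  "admissible_space T \<iota> D \<longleftrightarrow>
     D \<subseteq> extensional T \<and>
     (\<forall>f\<in>D. \<forall>g\<in>D. restrict (\<lambda>x. f x + g x) T \<in> D) \<and>
     (\<forall>c. \<forall>f\<in>D. restrict (\<lambda>x. c *\<^sub>R f x) T \<in> D) \<and>
     (\<forall>v. restrict (\<iota> v) T \<in> D)"

text \<open>The last clause says that \<open>l\<close> is well defined on fields modulo null sets.\<close>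

definition linear_functional_on ::
  "'a::euclidean_space set \<Rightarrow> ('a \<Rightarrow> 'b::euclidean_space) set \<Rightarrow> (('a \<Rightarrow> 'b) \<Rightarrow> real) \<Rightarrow> bool" where
  "linear_functional_on T D l \<longleftrightarrow>
     (\<forall>f\<in>D. \<forall>g\<in>D. l (restrict (\<lambda>x. f x + g x) T) = l f + l g) \<and>
     (\<forall>c. \<forall>f\<in>D. l (restrict (\<lambda>x. c *\<^sub>R f x) T) = c * l f) \<and>
     (\<forall>f\<in>D. \<forall>g\<in>D. (AE x in lebesgue_on T. f x = g x) \<longrightarrow> l f = l g)"

text \<open>Boundary values of a field on \<open>T\<close> that is given only up to null sets are taken in the
  sense of a trace; the trace of a field that is continuous on the closed cell \<open>T\<close> is its
  pointwise restriction to the boundary.\<close>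

definition trace_operator ::
  "'a::euclidean_space set \<Rightarrow> ('a \<Rightarrow> 'b::euclidean_space) set \<Rightarrow> (('a \<Rightarrow> 'b) \<Rightarrow> 'a \<Rightarrow> 'b) \<Rightarrow> bool" where
  "trace_operator T D \<gamma> \<longleftrightarrow> (\<forall>S. S facet_of T \<longrightarrow>
     (\<forall>f\<in>D. \<forall>g\<in>D. AE x in surface_measure S.
        \<gamma> (restrict (\<lambda>x. f x + g x) T) x = \<gamma> f x + \<gamma> g x) \<and>
     (\<forall>c. \<forall>f\<in>D. AE x in surface_measure S. \<gamma> (restrict (\<lambda>x. c *\<^sub>R f x) T) x = c *\<^sub>R \<gamma> f x) \<and>
     (\<forall>f\<in>D. \<forall>g\<in>D. (AE x in lebesgue_on T. f x = g x) \<longrightarrow>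
        (AE x in surface_measure S. \<gamma> f x = \<gamma> g x)) \<and>
     (\<forall>f\<in>D. continuous_on T f \<longrightarrow> (AE x in surface_measure S. \<gamma> f x = f x)))"

definition global_decomposition ::
  "'a::euclidean_space set set \<Rightarrow> ('v \<Rightarrow> 'a \<Rightarrow> 'b::euclidean_space) \<Rightarrow> ('a set \<Rightarrow> ('a \<Rightarrow> 'b) set) \<Rightarrow>
   ('v \<Rightarrow> real) \<Rightarrow> ('a set \<Rightarrow> ('a \<Rightarrow> 'b) \<Rightarrow> real) \<Rightarrow> bool" where
  "global_decomposition \<T> \<iota> D r rloc \<longleftrightarrow>
     (\<forall>T\<in>\<T>. linear_functional_on T (D T) (rloc T)) \<and>
     (\<forall>v. r v = (\<Sum>T\<in>\<T>. rloc T (restrict (\<iota> v) T)))"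

definition local_decomposition ::
  "'a::euclidean_space set \<Rightarrow> ('a \<Rightarrow> 'b::euclidean_space) set \<Rightarrow> (('a \<Rightarrow> 'b) \<Rightarrow> 'a \<Rightarrow> 'b) \<Rightarrow>
   (('a \<Rightarrow> 'b) \<Rightarrow> real) \<Rightarrow> ('a \<Rightarrow> 'b) \<Rightarrow> ('a \<Rightarrow> 'b) \<Rightarrow> bool" where
  "local_decomposition T D \<gamma> l R Rb \<longleftrightarrow>
     L2_field (lebesgue_on T) R \<and>
     (\<forall>S. S facet_of T \<longrightarrow> L2_field (surface_measure S) Rb) \<and>
     (\<forall>v\<in>D. L2_field (lebesgue_on T) v \<and>
        (\<forall>S. S facet_of T \<longrightarrow> L2_field (surface_measure S) (\<gamma> v)) \<and>
        l v = L2_inner_cell T R v + L2_inner_boundary T Rb (\<gamma> v))"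

definition polynomial_representation ::
  "nat \<Rightarrow> nat \<Rightarrow> 'a::euclidean_space set \<Rightarrow> ('a \<Rightarrow> 'b::euclidean_space) \<Rightarrow> ('a \<Rightarrow> 'b) \<Rightarrow> bool" where
  "polynomial_representation p q T R Rb \<longleftrightarrow>
     poly_field p T (lebesgue_on T) R \<and>
     (\<forall>S. S facet_of T \<longrightarrow> poly_field q S (surface_measure S) Rb)"

definition bubble_field ::
  "'a::euclidean_space set \<Rightarrow> ('a \<Rightarrow> real) \<Rightarrow> 'b::euclidean_space \<Rightarrow> 'a \<Rightarrow> 'b" where
  "bubble_field T \<phi> e = restrict (\<lambda>x. (bubble T x * \<phi> x) *\<^sub>R e) T"

definition cone_field ::
  "'a::euclidean_space set \<Rightarrow> 'a set \<Rightarrow> ('a \<Rightarrow> real) \<Rightarrow> 'b::euclidean_space \<Rightarrow> 'a \<Rightarrow> 'b" where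
  "cone_field T S \<phi> e = restrict (\<lambda>x. (cone_fun T S x * \<phi> x) *\<^sub>R e) T"

definition solves_cell_problem ::
  "nat \<Rightarrow> 'a::euclidean_space set \<Rightarrow> nat \<Rightarrow> (nat \<Rightarrow> 'a \<Rightarrow> real) \<Rightarrow> (('a \<Rightarrow> 'b::euclidean_space) \<Rightarrow> real) \<Rightarrow>
   'b \<Rightarrow> ('a \<Rightarrow> real) \<Rightarrow> bool" where
  "solves_cell_problem p T m \<phi> l e \<rho> \<longleftrightarrow>
     \<rho> \<in> poly_space p T \<and>
     (\<forall>i\<in>{1..m}. L2_inner_cell T \<rho> (\<lambda>x. bubble T x * \<phi> i x) = l (bubble_field T (\<phi> i) e))"

definition solves_facet_problem ::
  "nat \<Rightarrow> 'a::euclidean_space set \<Rightarrow> 'a set \<Rightarrow> nat \<Rightarrow> (nat \<Rightarrow> 'a \<Rightarrow> real) \<Rightarrow>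
   (('a \<Rightarrow> 'b::euclidean_space) \<Rightarrow> real) \<Rightarrow> 'b \<Rightarrow> ('a \<Rightarrow> real) \<Rightarrow> ('a \<Rightarrow> real) \<Rightarrow> bool" where
  "solves_facet_problem q T S n \<phi> l e \<rho> \<sigma> \<longleftrightarrow>
     \<sigma> \<in> poly_space q S \<and>
     (\<forall>i\<in>{1..n}. L2_inner_facet S \<sigma> (\<lambda>x. cone_fun T S x * \<phi> i x) =
        l (cone_field T S (\<phi> i) e) - L2_inner_cell T \<rho> (\<lambda>x. cone_fun T S x * \<phi> i x))"

end

theory Submission
  imports Defs
begin

text \<open>The given residuals themselves solve the local problems: the bubble test functions vanish on
  the boundary of the cell, and the cone test functions of a facet vanish on all other facets, so in
  the local decomposition only the term to be determined (and, for a facet, the already known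
  cell term) survives. A difference \<open>\<delta>\<close> of two solutions is a combination of the basis functions, so
  testing with it gives \<open>\<integral>w \<delta>\<^sup>2 = 0\<close> for the weight \<open>w\<close> (bubble or cone function), which is
  positive on a dense subset of the cell or facet; hence \<open>\<delta> = 0\<close>.\<close>

section \<open>Weighted testing against measures of full support\<close>

text \<open>Collects what Lebesgue measure on a cell and surface measure on a facet have in common,
  so that one uniqueness argument serves both local problems. \<open>open_nonnull\<close> says that
  the support is all of \<open>K\<close>.\<close>

locale full_support =
  fixes M :: "'a::euclidean_space measure" and K :: "'a set"
  assumes AE_mem: "AE x in M. x \<in> K"
    and integrable_continuous_on: "\<And>f :: 'a \<Rightarrow> real. continuous_on K f \<Longrightarrow> integrable M f"
    and open_nonnull: "\<And>U x. open U \<Longrightarrow> x \<in> K \<Longrightarrow> x \<in> U \<Longrightarrow> \<not> (AE y in M. y \<notin> U)"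
begin

text \<open>By continuity a nonzero value persists on a relatively open part of \<open>K\<close>,
  which cannot be a null set.\<close>

lemma AE_zero_imp_zero:
  fixes h :: "'a \<Rightarrow> real"
  assumes h: "continuous_on K h" and ae: "AE x in M. h x = 0" and x: "x \<in> K"
  shows "h x = 0"
proof (rule ccontr)
  assume "h x \<noteq> 0"
  have "openin (top_of_set K) (K \<inter> h -` (- {0}))"
    by (rule continuous_openin_preimage_gen[OF h]) auto
  then obtain U where U: "open U" "K \<inter> h -` (- {0}) = K \<inter> U"
    by (auto simp: openin_open)
  have "AE y in M. y \<notin> U"
    using ae AE_mem by eventually_elim (use U(2) in blast)
  moreover have "x \<in> U" using U(2) x \<open>h x \<noteq> 0\<close> by blast
  ultimately show False using open_nonnull[OF U(1) x] by blast
qed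

text \<open>The integrand is the nonnegative continuous function \<open>w * h^2\<close>, so it
  vanishes throughout \<open>K\<close>. Hence \<open>h\<close> is zero wherever \<open>w\<close> is
  positive, and density carries this to all of \<open>K\<close> because the zero set of
  \<open>h\<close> is relatively closed.\<close>

lemma weighted_square_zero:
  fixes w h :: "'a \<Rightarrow> real"
  assumes w: "continuous_on K w" "\<And>x. x \<in> K \<Longrightarrow> 0 \<le> w x"
    and dense: "K \<subseteq> closure {x \<in> K. 0 < w x}"
    and h: "continuous_on K h"
    and int: "(LINT x|M. h x * (w x * h x)) = 0" and x: "x \<in> K"
  shows "h x = 0"
proof -
  let ?g = "\<lambda>x. h x * (w x * h x)"
  have g: "continuous_on K ?g" by (intro continuous_intros w h)
  have "AE x in M. 0 \<le> ?g x"
    using AE_mem by eventually_elim (simp add: w(2) mult.left_commute[of "h _"])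
  with int have "AE x in M. ?g x = 0"
    by (subst (asm) integral_nonneg_eq_0_iff_AE[OF integrable_continuous_on[OF g]]) auto
  then have "?g y = 0" if "y \<in> K" for y
    using AE_zero_imp_zero[OF g] that by blast
  then have zero: "h y = 0" if "y \<in> {x \<in> K. 0 < w x}" for y
    using that by fastforce
  have "closedin (top_of_set K) (K \<inter> h -` {0})"
    by (rule continuous_closedin_preimage[OF h]) auto
  then obtain C where C: "closed C" "K \<inter> h -` {0} = K \<inter> C"
    by (auto simp: closedin_closed)
  have "{x \<in> K. 0 < w x} \<subseteq> C" using zero C(2) by blast
  then have "closure {x \<in> K. 0 < w x} \<subseteq> C" by (simp add: closure_minimal C(1))
  then show ?thesis using dense x C(2) by blast
qed

text \<open>By linearity the difference \<open>h\<close> may itself serve as test function, which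
  reduces the claim to \<open>weighted_square_zero\<close>. The \<open>\<phi> i\<close> form a
  spanning family for the difference rather than a basis, because a basis of the cell polynomials
  becomes in general linearly dependent on a facet.\<close>

lemma weighted_testing_unique:
  fixes w h :: "'a \<Rightarrow> real"
  assumes w: "continuous_on K w" "\<And>x. x \<in> K \<Longrightarrow> 0 \<le> w x"
    and dense: "K \<subseteq> closure {x \<in> K. 0 < w x}"
    and f: "continuous_on K f" and g: "continuous_on K g"
    and \<phi>: "\<And>i. i \<in> {1..m} \<Longrightarrow> continuous_on K (\<phi> i)"
    and comb: "\<And>x. x \<in> K \<Longrightarrow> f x - g x = (\<Sum>i=1..m. c i * \<phi> i x)"
    and eq: "\<And>i. i \<in> {1..m} \<Longrightarrow>
      L2_inner M f (\<lambda>x. w x * \<phi> i x) = L2_inner M g (\<lambda>x. w x * \<phi> i x)"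
    and x: "x \<in> K"
  shows "f x = g x"
proof -
  define h where "h x = f x - g x" for x
  have h: "continuous_on K h" unfolding h_def by (intro continuous_intros f g)
  have int: "integrable M (\<lambda>x. k x * (w x * \<phi> i x))"
    if "i \<in> {1..m}" "continuous_on K k" for k i
    by (intro integrable_continuous_on continuous_intros w \<phi> that)
  have "(LINT x|M. h x * (w x * \<phi> i x)) = 0" if i: "i \<in> {1..m}" for i
    using eq[OF i] int[OF i f] int[OF i g]
    by (simp add: h_def L2_inner_def left_diff_distrib)
  \<comment> \<open>Only the second factor \<open>h\<close> is expanded, so that every summand is
    one of the vanishing test integrals.\<close>
  moreover have "(LINT x|M. h x * (w x * h x)) =
      (LINT x|M. (\<Sum>i=1..m. c i * (h x * (w x * \<phi> i x))))"
  proof (rule integral_cong_AE)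
    show "(\<lambda>x. h x * (w x * h x)) \<in> borel_measurable M"
      by (intro borel_measurable_integrable integrable_continuous_on continuous_intros w h)
    show "(\<lambda>x. \<Sum>i=1..m. c i * (h x * (w x * \<phi> i x))) \<in> borel_measurable M"
      by (intro borel_measurable_integrable integrable_continuous_on continuous_intros w h \<phi>)
    show "AE x in M. h x * (w x * h x) = (\<Sum>i=1..m. c i * (h x * (w x * \<phi> i x)))"
      using AE_mem
    proof eventually_elim
      case (elim x)
      then have "h x = (\<Sum>i=1..m. c i * \<phi> i x)" using comb by (simp add: h_def)
      then have "h x * (w x * h x) = h x * (w x * (\<Sum>i=1..m. c i * \<phi> i x))" by simp
      then show ?case by (simp add: sum_distrib_left mult_ac)
    qed
  qed
  ultimately have "(LINT x|M. h x * (w x * h x)) = 0"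
    using int[OF _ h] by simp
  from weighted_square_zero[OF w dense h this x] show ?thesis by (simp add: h_def)
qed

end

section \<open>Full support of cell and surface measures\<close>

text \<open>Compactness makes the measure finite and continuous functions bounded. A convex set with
  interior lies in the closure of that interior, so an open set around a point of \<open>K\<close>
  meets \<open>interior K\<close> in a nonempty open set, which is not negligible.\<close>

lemma full_support_lebesgue_on:
  fixes K :: "'a::euclidean_space set"
  assumes "compact K" "convex K" "interior K \<noteq> {}"
  shows "full_support (lebesgue_on K) K"
proof
  have K: "K \<in> sets lebesgue" using assms(1) by (simp add: lmeasurable_compact fmeasurableD)
  interpret finite_measure "lebesgue_on K"
    by (rule finite_measure_lebesgue_on) (simp add: assms(1) lmeasurable_compact)
  show "AE x in lebesgue_on K. x \<in> K"
    by (rule AE_I2) (simp add: space_restrict_space)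
  show "integrable (lebesgue_on K) f" if f: "continuous_on K f" for f :: "'a \<Rightarrow> real"
  proof -
    obtain B where "\<And>x. x \<in> K \<Longrightarrow> norm (f x) \<le> B"
      using compact_imp_bounded[OF compact_continuous_image[OF f assms(1)]]
      by (auto simp: bounded_iff)
    then show ?thesis
      by (intro integrable_const_bound[where B = B] AE_I2
          continuous_imp_measurable_on_sets_lebesgue[OF f K])
        (simp add: space_restrict_space)
  qed
  show "\<not> (AE y in lebesgue_on K. y \<notin> U)" if U: "open U" "x \<in> K" "x \<in> U" for U x
  proof
    assume "AE y in lebesgue_on K. y \<notin> U"
    then have "AE y in lebesgue. y \<in> K \<longrightarrow> y \<notin> U"
      using K by (subst (asm) AE_restrict_space_iff) auto
    then have "negligible (U \<inter> interior K)"
      unfolding negligible_iff_null_sets completion.AE_iff_null_sets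
      by (rule completion.complete2[rotated]) (use interior_subset in auto)
    moreover have "U \<inter> interior K \<noteq> {}"
      using convex_closure_interior[OF assms(2,3)] closure_subset[of K] U
        open_Int_closure_eq_empty[OF U(1), of "interior K"] by blast
    ultimately show False
      using open_not_negligible[of "U \<inter> interior K"] U(1) by blast
  qed
qed

text \<open>In a complete measure space a change on a null set preserves measurability. This serves
  functions that are continuous on a facet but arbitrary elsewhere in the ambient space.\<close>

lemma measurable_completion_cong_AE:
  assumes g: "g \<in> measurable (completion M) N" and ae: "AE x in completion M. f x = g x"
    and f: "f \<in> space M \<rightarrow> space N"
  shows "f \<in> measurable (completion M) N"
proof (rule measurableI)
  show "f x \<in> space N" if "x \<in> space (completion M)" for x using f that by auto
  show "f -` A \<inter> space (completion M) \<in> sets (completion M)" if "A \<in> sets N" for A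
    by (rule completion.in_sets_AE[where A = "g -` A \<inter> space (completion M)"])
      (use ae measurable_sets[OF g that] in auto)
qed

context
  fixes S :: "'a::euclidean_space set"
  assumes S: "compact S" "convex S" "S \<noteq> {}"
begin

text \<open>The prism is the Minkowski sum of \<open>S\<close> and \<open>?Y\<close>, the ball of
  radius 1/2 cut with the subspace normal to \<open>S\<close>. Convexity follows from the same
  decomposition.\<close>

lemma compact_facet_prism: "compact (facet_prism S)"
proof -
  let ?Y = "cball 0 (1/2) \<inter> (\<Inter>a\<in>S. \<Inter>b\<in>S. {y. (a - b) \<bullet> y = 0})"
  have "compact ?Y"
    by (intro compact_Int_closed compact_cball closed_INT ballI closed_hyperplane)
  moreover have "facet_prism S = {x + y |x y. x \<in> S \<and> y \<in> ?Y}"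
    by (auto simp: facet_prism_def inner_commute)
  ultimately show ?thesis using compact_sums[OF S(1)] by (simp only:)
qed

lemma convex_facet_prism: "convex (facet_prism S)"
proof -
  let ?Y = "cball 0 (1/2) \<inter> (\<Inter>a\<in>S. \<Inter>b\<in>S. {y. (a - b) \<bullet> y = 0})"
  have "convex ?Y"
    by (intro convex_Int convex_cball convex_INT convex_hyperplane)
  moreover have "facet_prism S = (\<Union>x\<in>S. \<Union>y\<in>?Y. {x + y})"
    by (auto simp: facet_prism_def inner_commute) blast
  ultimately show ?thesis using convex_sums[OF S(2)] by simp
qed

lemma subset_facet_prism: "S \<subseteq> facet_prism S"
  unfolding facet_prism_def by (rule subsetI, rule CollectI) (rule exI, rule exI[of _ 0], simp)

text \<open>Otherwise the convex prism lies in a hyperplane with some normal \<open>a\<close>. Then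
  \<open>a\<close> is constant on \<open>S\<close>, hence orthogonal to it, and moving a point of
  \<open>S\<close> by the multiple of \<open>a\<close> of length 1/2 stays in the prism but leaves
  the hyperplane.\<close>

lemma interior_facet_prism: "interior (facet_prism S) \<noteq> {}"
proof
  assume "interior (facet_prism S) = {}"
  then obtain a b where a: "a \<noteq> 0" and sub: "facet_prism S \<subseteq> {x. a \<bullet> x = b}"
    using empty_interior_subset_hyperplane[OF convex_facet_prism] by metis
  obtain x where x: "x \<in> S" using S(3) by blast
  have "a \<bullet> y = b" if "y \<in> S" for y using that sub subset_facet_prism by blast
  then have "\<forall>y\<in>S. \<forall>z\<in>S. ((1 / (2 * norm a)) *\<^sub>R a) \<bullet> (y - z) = 0"
    by (simp add: inner_diff_right)
  then have "x + (1 / (2 * norm a)) *\<^sub>R a \<in> facet_prism S"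
    unfolding facet_prism_def using x a
    by (intro CollectI exI[of _ x] exI[of _ "(1 / (2 * norm a)) *\<^sub>R a"]) simp
  moreover have "a \<bullet> x = b" using x sub subset_facet_prism by blast
  ultimately show False using sub a by (auto simp: inner_add_right)
qed

lemma closest_point_measurable:
  "closest_point S \<in> measurable (restrict_space lborel (facet_prism S)) borel"
  using continuous_on_closest_point[OF S(2) compact_imp_closed[OF S(1)] S(3), of UNIV]
  by (intro measurable_restrict_space1) (simp add: borel_measurable_continuous_onI)

text \<open>The projection is continuous and fixes the points of \<open>S\<close>, so the preimage
  of an open set \<open>U\<close> around \<open>x\<close> is again an open neighbourhood of
  \<open>x\<close>. It meets the interior of the prism, whose closure contains \<open>x\<close>, and
  so has positive Lebesgue measure there.\<close>

lemma full_support_surface_measure: "full_support (surface_measure S) S"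
proof
  let ?P = "facet_prism S"
  let ?N = "restrict_space lborel ?P"
  let ?D = "distr ?N borel (closest_point S)"
  note cp = closest_point_measurable
  have closed: "closed S" using S(1) by (rule compact_imp_closed)
  have P: "?P \<in> sets lborel" using compact_facet_prism by (simp add: borel_compact)
  have mem: "AE x in ?D. x \<in> S"
    using closest_point_in_set[OF closed S(3)] closed by (subst AE_distr_iff[OF cp]) auto
  then show mem': "AE x in surface_measure S. x \<in> S"
    unfolding surface_measure_def by (rule AE_completion)
  have "emeasure ?N (space ?N) < \<infinity>"
    using emeasure_bounded_finite[OF compact_imp_bounded[OF compact_facet_prism]] P
    by (simp add: space_restrict_space emeasure_restrict_space)
  then have "finite_measure (distr ?N borel (closest_point S))"
    by (intro finite_measure.finite_measure_distr cp finite_measureI) auto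
  then interpret finite_measure "surface_measure S"
    unfolding surface_measure_def
    by (intro finite_measureI) (simp add: finite_measure.emeasure_finite emeasure_completion)
  show "integrable (surface_measure S) f" if f: "continuous_on S f" for f :: "'a \<Rightarrow> real"
  proof -
    obtain B where B: "\<And>x. x \<in> S \<Longrightarrow> norm (f x) \<le> B"
      using compact_imp_bounded[OF compact_continuous_image[OF f S(1)]]
      by (auto simp: bounded_iff)
    \<comment> \<open>The extension of \<open>f\<close> by zero is Borel and agrees with
      \<open>f\<close> almost everywhere.\<close>
    have "(\<lambda>x. indicator S x *\<^sub>R f x) \<in> borel_measurable ?D"
      using borel_measurable_continuous_on_indicator[OF borel_closed[OF closed] f] by simp
    then have "f \<in> borel_measurable (surface_measure S)"
      unfolding surface_measure_def
      by (rule measurable_completion_cong_AE[OF measurable_completion])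
        (use AE_completion[OF mem] in \<open>auto elim: eventually_mono\<close>)
    moreover have "AE x in surface_measure S. norm (f x) \<le> B"
      using mem' by eventually_elim (rule B)
    ultimately show ?thesis by (intro integrable_const_bound)
  qed
  show "\<not> (AE y in surface_measure S. y \<notin> U)" if U: "open U" "x \<in> S" "x \<in> U" for U x
  proof
    assume "AE y in surface_measure S. y \<notin> U"
    \<comment> \<open>The null-set statement is pulled back through completion, push-forward and
      restriction to Lebesgue measure.\<close>
    then have "AE y in ?D. y \<notin> U"
      unfolding surface_measure_def AE_completion_iff .
    then have "AE y in ?N. closest_point S y \<notin> U"
      using U(1) by (subst (asm) AE_distr_iff[OF cp]) (auto intro: borel_closed simp flip: Compl_eq)
    then have "AE y in lebesgue. y \<in> ?P \<longrightarrow> closest_point S y \<notin> U"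
      using P by (subst (asm) AE_restrict_space_iff) (auto intro: AE_completion)
    then have "negligible (closest_point S -` U \<inter> interior ?P)"
      unfolding negligible_iff_null_sets completion.AE_iff_null_sets
      by (rule completion.complete2[rotated]) (use interior_subset in auto)
    moreover have V: "open (closest_point S -` U)"
      using continuous_on_closest_point[OF S(2) closed S(3), of UNIV] U(1)
      by (simp add: continuous_on_open_vimage)
    have "x \<in> closest_point S -` U \<inter> closure (interior ?P)"
      using U closest_point_self[of x S] convex_closure_interior[OF convex_facet_prism interior_facet_prism]
        closure_subset[of ?P] subset_facet_prism by auto
    then have "closest_point S -` U \<inter> interior ?P \<noteq> {}"
      using open_Int_closure_eq_empty[OF V, of "interior ?P"] by blast
    ultimately show False
      using open_not_negligible[of "closest_point S -` U \<inter> interior ?P"] V by blast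
  qed
qed

end

section \<open>Barycentric coordinates of a simplex\<close>

text \<open>The edge vectors \<open>w - v\<close> are independent, so some linear \<open>g\<close>
  equals 1 on all of them; on the point minus \<open>v\<close> it yields the sum of the other
  weights. Thus a weight is an affine function of the point, which gives both its uniqueness and its
  continuity. Weights may be negative, as in the definition of \<open>barycentric\<close>.\<close>

lemma barycentric_affine:
  fixes C :: "'a::euclidean_space set"
  assumes C: "\<not> affine_dependent C" and v: "v \<in> C"
  obtains g :: "'a \<Rightarrow> real" where "linear g"
    "\<And>u. sum u C = 1 \<Longrightarrow> u v = 1 - g ((\<Sum>w\<in>C. u w *\<^sub>R w) - v)"
proof -
  have fin: "finite C" using C by (rule aff_independent_finite)
  have "independent ((\<lambda>x. - v + x) ` (C - {v}))"
    using C affine_dependent_iff_dependent2[OF v] by blast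
  from linear_independent_extend[OF this, of "\<lambda>_. 1 :: real"]
  obtain g :: "'a \<Rightarrow> real" where g: "linear g" "\<And>w. w \<in> C - {v} \<Longrightarrow> g (w - v) = 1"
    by auto
  have "u v = 1 - g ((\<Sum>w\<in>C. u w *\<^sub>R w) - v)" if u: "sum u C = 1" for u
  proof -
    have "(\<Sum>w\<in>C. u w *\<^sub>R w) - v = (\<Sum>w\<in>C. u w *\<^sub>R (w - v))"
      by (simp add: scaleR_diff_right sum_subtractf u flip: scaleR_left.sum)
    then have "g ((\<Sum>w\<in>C. u w *\<^sub>R w) - v) = (\<Sum>w\<in>C. u w * g (w - v))"
      by (simp add: linear_sum[OF g(1)] linear_scale[OF g(1)])
    also have "\<dots> = (\<Sum>w\<in>C - {v}. u w)"
      using g(2) by (simp add: sum.remove[OF fin v] linear_0[OF g(1)])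
    also have "\<dots> = 1 - u v" using u by (simp add: sum_diff1 fin v)
    finally show ?thesis by simp
  qed
  with g(1) show thesis by (rule that)
qed

lemma vertices_convex_hull:
  "\<not> affine_dependent C \<Longrightarrow> vertices (convex hull C) = C"
  by (simp add: vertices_def extreme_point_of_convex_hull_affine_independent)

lemma barycentric_eq:
  assumes C: "\<not> affine_dependent C" and v: "v \<in> C" and u: "sum u C = 1"
  shows "barycentric (convex hull C) v (\<Sum>w\<in>C. u w *\<^sub>R w) = u v"
proof -
  from barycentric_affine[OF C v] obtain g :: "'a \<Rightarrow> real" where
    g: "\<And>u. sum u C = 1 \<Longrightarrow> u v = 1 - g ((\<Sum>w\<in>C. u w *\<^sub>R w) - v)" by metis
  show ?thesis
    unfolding barycentric_def vertices_convex_hull[OF C]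
  proof (rule the_equality)
    fix t
    assume "\<exists>u'. sum u' C = 1 \<and> (\<Sum>w\<in>C. u' w *\<^sub>R w) = (\<Sum>w\<in>C. u w *\<^sub>R w) \<and> t = u' v"
    then show "t = u v" using g u by metis
  qed (use u in blast)
qed

text \<open>Convex weights over \<open>B\<close> are extended by zero to \<open>C\<close>. With a
  proper subset \<open>B\<close> this shows that the coordinates of the omitted vertices vanish on
  the face spanned by \<open>B\<close>.\<close>

lemma convex_hull_barycentric:
  assumes C: "\<not> affine_dependent C" and B: "B \<subseteq> C" and x: "x \<in> convex hull B"
  obtains u where "sum u C = 1" "x = (\<Sum>w\<in>C. u w *\<^sub>R w)" "\<And>w. 0 \<le> u w"
    "\<And>w. w \<notin> B \<Longrightarrow> u w = 0" "\<And>v. v \<in> C \<Longrightarrow> barycentric (convex hull C) v x = u v"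
proof -
  have fin: "finite C" using C by (rule aff_independent_finite)
  have "finite B" using B fin by (rule finite_subset)
  with x obtain u where u: "\<forall>w\<in>B. 0 \<le> u w" "sum u B = 1" "(\<Sum>w\<in>B. u w *\<^sub>R w) = x"
    by (auto simp: convex_hull_finite)
  let ?u = "\<lambda>w. if w \<in> B then u w else 0"
  have 1: "sum ?u C = 1"
    using u(2) by (simp add: sum.If_cases fin Int_absorb1[OF B])
  have 2: "x = (\<Sum>w\<in>C. ?u w *\<^sub>R w)"
    using u(3) by (simp add: if_distrib[of "\<lambda>a. a *\<^sub>R _"] sum.If_cases fin Int_absorb1[OF B] cong: if_cong)
  show thesis
    by (rule that[OF 1 2]) (use u(1) barycentric_eq[OF C _ 1] 2 in auto)
qed

lemma continuous_on_barycentric: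
  assumes C: "\<not> affine_dependent C" and v: "v \<in> C"
  shows "continuous_on (convex hull C) (barycentric (convex hull C) v)"
proof -
  from barycentric_affine[OF C v] obtain g :: "'a \<Rightarrow> real" where g: "linear g"
    "\<And>u. sum u C = 1 \<Longrightarrow> u v = 1 - g ((\<Sum>w\<in>C. u w *\<^sub>R w) - v)" by metis
  have "barycentric (convex hull C) v x = 1 - g (x - v)" if "x \<in> convex hull C" for x
    using convex_hull_barycentric[OF C subset_refl that] g(2) v by metis
  moreover have "continuous_on (convex hull C) (\<lambda>x. 1 - g (x - v))"
    by (intro continuous_intros linear_continuous_on_compose[OF _ g(1)])
  ultimately show ?thesis by (simp cong: continuous_on_cong)
qed

section \<open>Bubble and cone functions as products of coordinates\<close>

text \<open>Common form of both weights: \<open>B = C\<close> gives the bubble function,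
  \<open>B = C - {u}\<close> the cone function of the facet opposite \<open>u\<close>.\<close>

definition vertex_product :: "'a::euclidean_space set \<Rightarrow> 'a set \<Rightarrow> 'a \<Rightarrow> real" where
  "vertex_product C B x = (\<Prod>v\<in>B. barycentric (convex hull C) v x)"

lemma bubble_eq_vertex_product:
  "\<not> affine_dependent C \<Longrightarrow> bubble (convex hull C) = vertex_product C C"
  by (simp add: fun_eq_iff bubble_def vertex_product_def vertices_convex_hull)

text \<open>A vertex in the hull of \<open>B\<close> but outside \<open>B\<close> would lie in the
  affine hull of the other vertices, contradicting affine independence.\<close>

lemma cone_fun_eq_vertex_product:
  assumes C: "\<not> affine_dependent C" and B: "B \<subseteq> C"
  shows "cone_fun (convex hull C) (convex hull B) = vertex_product C B"
proof -
  have "{v \<in> C. v \<in> convex hull B} = B"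
  proof (intro equalityI subsetI)
    fix v assume v: "v \<in> {v \<in> C. v \<in> convex hull B}"
    show "v \<in> B"
    proof (rule ccontr)
      assume "v \<notin> B"
      then have "convex hull B \<subseteq> affine hull (C - {v})"
        using B convex_hull_subset_affine_hull[of "C - {v}"] hull_mono[of B "C - {v}" convex] by blast
      with v C show False by (auto simp: affine_dependent_def)
    qed
  qed (use B hull_inc in fast)
  then show ?thesis
    by (simp add: fun_eq_iff cone_fun_def vertex_product_def vertices_convex_hull[OF C])
qed

context
  fixes B C :: "'a::euclidean_space set"
  assumes C: "\<not> affine_dependent C" and B: "B \<subseteq> C"
begin

lemma continuous_on_vertex_product: "continuous_on (convex hull C) (vertex_product C B)"
  unfolding vertex_product_def
  by (intro continuous_on_prod continuous_on_barycentric[OF C]) (use B in blast)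

lemma vertex_product_nonneg: "x \<in> convex hull C \<Longrightarrow> 0 \<le> vertex_product C B x"
  unfolding vertex_product_def using B
  by (intro prod_nonneg) (metis convex_hull_barycentric[OF C subset_refl] subsetD)

text \<open>The factor of \<open>u\<close> vanishes on the facet opposite \<open>u\<close>. Hence
  the bubble function is zero on every facet, and a cone function on every facet but its
  own.\<close>

lemma vertex_product_zero:
  assumes "u \<in> B" "x \<in> convex hull (C - {u})"
  shows "vertex_product C B x = 0"
proof -
  have "barycentric (convex hull C) u x = 0"
    using convex_hull_barycentric[OF C Diff_subset assms(2)] assms(1) B
    by (metis Diff_iff singletonI subsetD)
  then show ?thesis
    unfolding vertex_product_def
    using assms(1) finite_subset[OF B aff_independent_finite[OF C]] by (intro prod_zero) auto
qed

text \<open>Every point of the hull of \<open>B\<close> is a limit of points shifted towards the centroid of \<open>B\<close>,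
  all of whose coordinates over \<open>B\<close> are positive.\<close>

lemma vertex_product_pos_dense:
  "convex hull B \<subseteq> closure {x \<in> convex hull B. 0 < vertex_product C B x}"
proof
  fix x assume x: "x \<in> convex hull B"
  then have ne: "B \<noteq> {}" by auto
  have fin: "finite C" "finite B"
    using aff_independent_finite[OF C] B finite_subset by auto
  obtain u where u: "sum u C = 1" "x = (\<Sum>w\<in>C. u w *\<^sub>R w)" "\<And>w. 0 \<le> u w"
    "\<And>w. w \<notin> B \<Longrightarrow> u w = 0"
    using convex_hull_barycentric[OF C B x] by metis
  \<comment> \<open>The barycentric coordinates, over all of \<open>C\<close>, of the centroid
    \<open>c\<close> of \<open>B\<close>.\<close>
  define z where "z w = (if w \<in> B then 1 / real (card B) else 0)" for w
  define c where "c = (\<Sum>w\<in>C. z w *\<^sub>R w)"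
  have z: "sum z C = 1"
    using ne fin by (simp add: z_def sum.If_cases Int_absorb1[OF B])
  have "c = (\<Sum>w\<in>B. (1 / real (card B)) *\<^sub>R w)"
    unfolding c_def z_def
    using fin by (simp add: if_distrib[of "\<lambda>a. a *\<^sub>R _"] sum.If_cases Int_absorb1[OF B] cong: if_cong)
  then have c: "c \<in> convex hull B"
    using ne fin(2) by (auto simp: convex_hull_finite intro!: exI[of _ "\<lambda>_. 1 / real (card B)"])
  \<comment> \<open>\<open>Suc k\<close> keeps the step in (0, 1] from \<open>k = 0\<close> on, so
    each \<open>y k\<close> is a convex combination with a positive share of
    \<open>c\<close>.\<close>
  define s where "s k = 1 / real (Suc k)" for k
  define y where "y k = (1 - s k) *\<^sub>R x + s k *\<^sub>R c" for k
  have s: "0 < s k" "s k \<le> 1" for k by (auto simp: s_def)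
  have "y k \<in> {x \<in> convex hull B. 0 < vertex_product C B x}" for k
  proof -
    have "y k \<in> convex hull B"
      unfolding y_def using s[of k] by (intro convexD[OF convex_convex_hull] x c) auto
    moreover have "barycentric (convex hull C) v (y k) > 0" if v: "v \<in> B" for v
    proof -
      let ?t = "\<lambda>w. (1 - s k) * u w + s k * z w"
      have "sum ?t C = 1"
        by (simp add: sum.distrib u(1) z flip: sum_distrib_left)
      moreover have "y k = (\<Sum>w\<in>C. ?t w *\<^sub>R w)"
        by (simp add: y_def u(2) c_def scaleR_sum_right sum.distrib scaleR_add_left)
      ultimately have "barycentric (convex hull C) v (y k) = ?t v"
        using barycentric_eq[OF C, of v ?t] v B by auto
      moreover have "0 < z v" using v ne fin(2) by (simp add: z_def card_gt_0_iff)
      ultimately show ?thesis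
        using s[of k] u(3)[of v] by (simp add: add_nonneg_pos)
    qed
    ultimately show ?thesis by (auto simp: vertex_product_def intro: prod_pos)
  qed
  moreover have "s \<longlonglongrightarrow> 0" unfolding s_def by (rule LIMSEQ_Suc[OF lim_1_over_n])
  then have "y \<longlonglongrightarrow> (1 - 0) *\<^sub>R x + 0 *\<^sub>R c"
    unfolding y_def by (intro tendsto_intros)
  ultimately show "x \<in> closure {x \<in> convex hull B. 0 < vertex_product C B x}"
    unfolding closure_sequential by auto
qed

end

section \<open>Polynomial spaces and scalar components of the decomposition\<close>

lemma continuous_on_poly_space: "f \<in> poly_space k K \<Longrightarrow> continuous_on K f"
  unfolding poly_space_def by (auto intro!: continuous_intros cong: continuous_on_cong)

text \<open>The same coefficients define a polynomial on the larger set. This links polynomials on a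
  facet to the basis of the facet problem, which lives on the whole cell.\<close>

lemma poly_space_diff_extend:
  assumes "f \<in> poly_space k S" "g \<in> poly_space k S" "S \<subseteq> T"
  obtains h where "h \<in> poly_space k T" "\<And>x. x \<in> S \<Longrightarrow> h x = f x - g x"
proof -
  obtain c c' where
    f: "f = restrict (\<lambda>x. \<Sum>\<alpha>\<in>multi_indices k. c \<alpha> * (\<Prod>b\<in>Basis. (x \<bullet> b) ^ \<alpha> b)) S" and
    g: "g = restrict (\<lambda>x. \<Sum>\<alpha>\<in>multi_indices k. c' \<alpha> * (\<Prod>b\<in>Basis. (x \<bullet> b) ^ \<alpha> b)) S"
    using assms(1,2) by (auto simp: poly_space_def)
  let ?h = "restrict (\<lambda>x. \<Sum>\<alpha>\<in>multi_indices k. (c \<alpha> - c' \<alpha>) * (\<Prod>b\<in>Basis. (x \<bullet> b) ^ \<alpha> b)) T"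
  have "?h \<in> poly_space k T"
    unfolding poly_space_def by (rule CollectI, rule exI[of _ "\<lambda>\<alpha>. c \<alpha> - c' \<alpha>"], rule conjI, rule refl, rule TrueI)
  moreover have "?h x = f x - g x" if "x \<in> S" for x
    using that assms(3) by (auto simp: f g left_diff_distrib sum_subtractf)
  ultimately show thesis by (rule that)
qed

lemma poly_space_eqI:
  assumes "f \<in> poly_space k K" "g \<in> poly_space k K" "\<And>x. x \<in> K \<Longrightarrow> f x = g x"
  shows "f = g"
  using assms by (intro extensionalityI[of f K g]) (auto simp: poly_space_def)

lemma L2_inner_cong_AE:
  assumes "AE x in M. f x \<bullet> k x = f' x \<bullet> k' x"
    and "(\<lambda>x. f x \<bullet> k x) \<in> borel_measurable M" "(\<lambda>x. f' x \<bullet> k' x) \<in> borel_measurable M"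
  shows "L2_inner M f k = L2_inner M f' k'"
  unfolding L2_inner_def using assms by (intro integral_cong_AE)

text \<open>A test field with the single component \<open>e\<close> sees only the component
  \<open>F x \<bullet> e\<close>, so the product of fields becomes a scalar one, with the almost
  everywhere representatives replaced by continuous functions.\<close>

lemma (in full_support) L2_inner_component:
  fixes F :: "'a \<Rightarrow> 'b::euclidean_space" and g k :: "'a \<Rightarrow> real"
  assumes F: "F \<in> borel_measurable M" "AE x in M. F x \<bullet> e = g x" "continuous_on K g"
    and f: "f \<in> borel_measurable M" "AE x in M. f x = k x *\<^sub>R e" "continuous_on K k"
  shows "L2_inner M F f = L2_inner M g k"
proof (rule L2_inner_cong_AE)
  show "AE x in M. F x \<bullet> f x = g x \<bullet> k x"
    using F(2) f(2) by eventually_elim (simp add: mult.commute)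
  show "(\<lambda>x. F x \<bullet> f x) \<in> borel_measurable M"
    using F(1) f(1) by (rule borel_measurable_inner)
  show "(\<lambda>x. g x \<bullet> k x) \<in> borel_measurable M"
    by (intro borel_measurable_integrable integrable_continuous_on continuous_intros F f)
qed

text \<open>The local decomposition for one scalar component. Since the test field is continuous on
  the closed cell, its trace is its pointwise restriction, and the residual components are replaced
  by continuous representatives \<open>g\<close> and \<open>h S\<close>.\<close>

lemma local_functional_scalar_field:
  fixes T :: "'a::euclidean_space set" and e :: "'b::euclidean_space"
  assumes T: "full_support (lebesgue_on T) T"
    and S: "\<And>S. S facet_of T \<Longrightarrow> full_support (surface_measure S) S"
    and tr: "trace_operator T D \<gamma>"
    and dec: "local_decomposition T D \<gamma> l R Rb"
    and f: "restrict (\<lambda>x. k x *\<^sub>R e) T \<in> D" and k: "continuous_on T k"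
    and g: "continuous_on T g" "AE x in lebesgue_on T. R x \<bullet> e = g x"
    and h: "\<And>S. S facet_of T \<Longrightarrow> continuous_on S (h S)"
      "\<And>S. S facet_of T \<Longrightarrow> AE x in surface_measure S. Rb x \<bullet> e = h S x"
  shows "l (restrict (\<lambda>x. k x *\<^sub>R e) T) =
    L2_inner_cell T g k + (\<Sum>S\<in>{S. S facet_of T}. L2_inner_facet S (h S) k)"
proof -
  let ?f = "restrict (\<lambda>x. k x *\<^sub>R e) T"
  have "L2_inner_cell T R ?f = L2_inner_cell T g k"
    unfolding L2_inner_cell_def
  proof (rule full_support.L2_inner_component[OF T _ g(2,1) _ _ k])
    show "R \<in> borel_measurable (lebesgue_on T)" "?f \<in> borel_measurable (lebesgue_on T)"
      using dec f by (auto simp: local_decomposition_def L2_field_def)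
    show "AE x in lebesgue_on T. ?f x = k x *\<^sub>R e"
      using full_support.AE_mem[OF T] by eventually_elim simp
  qed
  moreover have "L2_inner_facet F Rb (\<gamma> ?f) = L2_inner_facet F (h F) k" if F: "F facet_of T" for F
    unfolding L2_inner_facet_def
  proof (rule full_support.L2_inner_component[OF S[OF F] _ h(2,1)[OF F] ])
    show "Rb \<in> borel_measurable (surface_measure F)" "\<gamma> ?f \<in> borel_measurable (surface_measure F)"
      using dec f F by (auto simp: local_decomposition_def L2_field_def)
    have sub: "F \<subseteq> T" using F by (rule facet_of_imp_subset)
    then show "continuous_on F k" by (rule continuous_on_subset[OF k])
    have "continuous_on T ?f" using k by (auto intro!: continuous_intros cong: continuous_on_cong)
    then have "AE x in surface_measure F. \<gamma> ?f x = ?f x"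
      using tr f F unfolding trace_operator_def by blast
    then show "AE x in surface_measure F. \<gamma> ?f x = k x *\<^sub>R e"
      using full_support.AE_mem[OF S[OF F]] by eventually_elim (use sub in auto)
  qed
  ultimately show ?thesis
    using dec f by (simp add: local_decomposition_def L2_inner_boundary_def)
qed

lemma (in full_support) L2_inner_zero:
  fixes f g :: "'a \<Rightarrow> real"
  assumes "\<And>x. x \<in> K \<Longrightarrow> g x = 0"
  shows "L2_inner M f g = 0"
  unfolding L2_inner_def
  by (rule integral_eq_zero_AE, use AE_mem in eventually_elim) (simp add: assms)

section \<open>Existence and uniqueness for the local problems\<close>

text \<open>The difference of two solutions extends to a polynomial of the same degree on
  \<open>T\<close> and is thus a combination of the basis, so weighted testing applies.
  \<open>K = T\<close> is the cell problem, \<open>K = S\<close> the facet problem.\<close>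

lemma local_problem_unique:
  assumes K: "full_support M K" "K \<subseteq> T"
    and \<phi>: "poly_basis k T m \<phi>"
    and w: "continuous_on K w" "\<And>x. x \<in> K \<Longrightarrow> 0 \<le> w x" "K \<subseteq> closure {x \<in> K. 0 < w x}"
    and f: "f \<in> poly_space k K" and g: "g \<in> poly_space k K"
    and eq: "\<And>i. i \<in> {1..m} \<Longrightarrow>
      L2_inner M f (\<lambda>x. w x * \<phi> i x) = L2_inner M g (\<lambda>x. w x * \<phi> i x)"
  shows "f = g"
proof (rule poly_space_eqI[OF f g])
  fix x assume x: "x \<in> K"
  obtain h where h: "h \<in> poly_space k T" "\<And>x. x \<in> K \<Longrightarrow> h x = f x - g x"
    using poly_space_diff_extend[OF f g K(2)] by metis
  with \<phi> obtain c where "\<And>x. x \<in> T \<Longrightarrow> h x = (\<Sum>i=1..m. c i * \<phi> i x)"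
    unfolding poly_basis_def by meson
  then have comb: "f x - g x = (\<Sum>i=1..m. c i * \<phi> i x)" if "x \<in> K" for x
    using h(2) that K(2) by (metis subsetD)
  have cont: "continuous_on K (\<phi> i)" if "i \<in> {1..m}" for i
    using \<phi> that by (intro continuous_on_subset[OF continuous_on_poly_space K(2)])
      (auto simp: poly_basis_def)
  show "f x = g x"
    by (rule full_support.weighted_testing_unique[OF K(1) w(1,2,3)
        continuous_on_poly_space[OF f] continuous_on_poly_space[OF g] cont comb eq x])
qed

lemma simplex_local_problems:
  fixes T :: "'a::euclidean_space set" and e :: "'b::euclidean_space"
  assumes T: "int DIM('a) simplex T"
    and tr: "trace_operator T D \<gamma>"
    and dec: "local_decomposition T D \<gamma> l R Rb"
    and pol: "polynomial_representation p q T R Rb"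
    and \<phi>: "poly_basis p T m \<phi>" and \<psi>: "poly_basis q T n \<psi>"
    and e: "e \<in> Basis"
    and bubble: "\<And>i. i \<in> {1..m} \<Longrightarrow> bubble_field T (\<phi> i) e \<in> D"
    and cone: "\<And>S i. S facet_of T \<Longrightarrow> i \<in> {1..n} \<Longrightarrow> cone_field T S (\<psi> i) e \<in> D"
  obtains g h where "solves_cell_problem p T m \<phi> l e g"
    "\<And>\<rho>. solves_cell_problem p T m \<phi> l e \<rho> \<Longrightarrow> \<rho> = g"
    "AE x in lebesgue_on T. R x \<bullet> e = g x"
    "\<And>S. S facet_of T \<Longrightarrow> solves_facet_problem q T S n \<psi> l e g (h S)"
    "\<And>S \<sigma>. S facet_of T \<Longrightarrow> solves_facet_problem q T S n \<psi> l e g \<sigma> \<Longrightarrow> \<sigma> = h S"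
    "\<And>S. S facet_of T \<Longrightarrow> AE x in surface_measure S. Rb x \<bullet> e = h S x"
proof -
  from T obtain C where C: "\<not> affine_dependent C" and T_eq: "T = convex hull C"
    unfolding simplex_def by blast
  \<comment> \<open>The simplex has full dimension, so its interior is its relative interior, which
    is nonempty by convexity.\<close>
  have "interior T \<noteq> {}"
  proof -
    have "aff_dim T = int DIM('a)" using T by (rule aff_dim_simplex)
    then have "affine hull T = UNIV" "T \<noteq> {}" by (auto simp: aff_dim_eq_full)
    then show ?thesis
      using rel_interior_interior[of T] rel_interior_eq_empty[of T] by (simp add: T_eq)
  qed
  moreover have "compact T" "convex T"
    using finite_imp_compact_convex_hull[OF aff_independent_finite[OF C]] by (simp_all add: T_eq)
  ultimately have fsT: "full_support (lebesgue_on T) T" by (intro full_support_lebesgue_on)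
  have facet: "\<exists>u\<in>C. S = convex hull (C - {u})" if "S facet_of T" for S
    using that facet_of_convex_hull_affine_independent[OF C] by (auto simp: T_eq)
  have fsS: "full_support (surface_measure S) S" if S: "S facet_of T" for S
  proof (rule full_support_surface_measure)
    show "compact S" "convex S" "S \<noteq> {}"
      using facet[OF S] S aff_independent_finite[OF C]
      by (auto intro: finite_imp_compact_convex_hull simp: facet_of_def)
  qed
  have fin: "finite {S. S facet_of T}"
    using T simplex_imp_polytope finite_polytope_facets by blast
  \<comment> \<open>The solutions are the polynomial representatives of the component
    \<open>e\<close> of the given residuals: \<open>g\<close> on the cell and \<open>h S\<close> on
    each facet.\<close>
  obtain g where g: "g \<in> poly_space p T" "AE x in lebesgue_on T. R x \<bullet> e = g x"
    using pol e by (auto simp: polynomial_representation_def poly_field_def)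
  have "\<exists>h. S facet_of T \<longrightarrow> h \<in> poly_space q S \<and> (AE x in surface_measure S. Rb x \<bullet> e = h x)" for S
    using pol e unfolding polynomial_representation_def poly_field_def by blast
  then obtain h where h: "\<And>S. S facet_of T \<Longrightarrow> h S \<in> poly_space q S"
    "\<And>S. S facet_of T \<Longrightarrow> AE x in surface_measure S. Rb x \<bullet> e = h S x" by metis
  note functional = local_functional_scalar_field[OF fsT fsS tr dec _ _
      continuous_on_poly_space[OF g(1)] g(2) continuous_on_poly_space[OF h(1)] h(2)]
  have bub: "bubble T = vertex_product C C"
    by (simp add: T_eq bubble_eq_vertex_product[OF C])
  note wC = continuous_on_vertex_product[OF C subset_refl, folded T_eq]
    vertex_product_nonneg[OF C subset_refl, folded T_eq]
    vertex_product_pos_dense[OF C subset_refl, folded T_eq]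
  have cell: "solves_cell_problem p T m \<phi> l e g"
    unfolding solves_cell_problem_def
  proof (intro conjI ballI g(1))
    fix i assume i: "i \<in> {1..m}"
    let ?k = "\<lambda>x. bubble T x * \<phi> i x"
    have "continuous_on T ?k"
      unfolding bub using \<phi> i
      by (intro continuous_intros wC continuous_on_poly_space) (auto simp: poly_basis_def)
    then have "l (bubble_field T (\<phi> i) e) =
        L2_inner_cell T g ?k + (\<Sum>S\<in>{S. S facet_of T}. L2_inner_facet S (h S) ?k)"
      using bubble[OF i] unfolding bubble_field_def by (intro functional)
    \<comment> \<open>Every facet is opposite some vertex \<open>u\<close>, and the bubble function
      contains the factor of \<open>u\<close>.\<close>
    moreover have "L2_inner_facet S (h S) ?k = 0" if S: "S facet_of T" for S
      unfolding L2_inner_facet_def bub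
      using facet[OF S] vertex_product_zero[OF C subset_refl]
      by (intro full_support.L2_inner_zero[OF fsS[OF S]]) auto
    ultimately show "L2_inner_cell T g ?k = l (bubble_field T (\<phi> i) e)" by simp
  qed
  have cell_unique: "\<rho> = g" if "solves_cell_problem p T m \<phi> l e \<rho>" for \<rho>
    using that cell unfolding solves_cell_problem_def bub L2_inner_cell_def
    by (intro local_problem_unique[OF fsT subset_refl \<phi> wC]) auto
  have facet_problem: "solves_facet_problem q T S n \<psi> l e g (h S) \<and>
      (\<forall>\<sigma>. solves_facet_problem q T S n \<psi> l e g \<sigma> \<longrightarrow> \<sigma> = h S)" if S: "S facet_of T" for S
  proof -
    from facet[OF S] obtain u where u: "u \<in> C" "S = convex hull (C - {u})" by blast
    have cf: "cone_fun T S = vertex_product C (C - {u})"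
      unfolding T_eq u(2) by (rule cone_fun_eq_vertex_product[OF C Diff_subset])
    have sub: "S \<subseteq> T" using S by (rule facet_of_imp_subset)
    note wT = continuous_on_vertex_product[OF C Diff_subset[of C "{u}"], folded T_eq]
    have wS: "continuous_on S (cone_fun T S)" "\<And>x. x \<in> S \<Longrightarrow> 0 \<le> cone_fun T S x"
      "S \<subseteq> closure {x \<in> S. 0 < cone_fun T S x}"
      unfolding cf
      using continuous_on_subset[OF wT sub] vertex_product_nonneg[OF C Diff_subset[of C "{u}"]] sub
        vertex_product_pos_dense[OF C Diff_subset[of C "{u}"]]
      by (auto simp: T_eq u(2))
    have sol: "solves_facet_problem q T S n \<psi> l e g (h S)"
      unfolding solves_facet_problem_def
    proof (intro conjI ballI h(1)[OF S])
      fix i assume i: "i \<in> {1..n}"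
      let ?k = "\<lambda>x. cone_fun T S x * \<psi> i x"
      have "continuous_on T ?k"
        unfolding cf using \<psi> i
        by (intro continuous_intros wT continuous_on_poly_space) (auto simp: poly_basis_def)
      then have "l (cone_field T S (\<psi> i) e) =
          L2_inner_cell T g ?k + (\<Sum>S\<in>{S. S facet_of T}. L2_inner_facet S (h S) ?k)"
        using cone[OF S i] unfolding cone_field_def by (intro functional)
      \<comment> \<open>\<open>S'\<close> is opposite a vertex \<open>u'\<close> different from
        \<open>u\<close>, and the coordinate of \<open>u'\<close> is a factor of the cone function
        of \<open>S\<close>.\<close>
      moreover have "L2_inner_facet S' (h S') ?k = 0" if S': "S' facet_of T" "S' \<noteq> S" for S'
      proof -
        from facet[OF S'(1)] obtain u' where "u' \<in> C" "S' = convex hull (C - {u'})" by blast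
        with u(2) S'(2) show ?thesis
          unfolding L2_inner_facet_def cf
          using vertex_product_zero[OF C Diff_subset[of C "{u}"], of u']
          by (intro full_support.L2_inner_zero[OF fsS[OF S'(1)]]) auto
      qed
      then have "(\<Sum>S\<in>{S. S facet_of T}. L2_inner_facet S (h S) ?k) = L2_inner_facet S (h S) ?k"
        using S fin by (subst sum.remove[of _ S]) auto
      ultimately show "L2_inner_facet S (h S) ?k =
          l (cone_field T S (\<psi> i) e) - L2_inner_cell T g ?k" by simp
    qed
    have "\<sigma> = h S" if "solves_facet_problem q T S n \<psi> l e g \<sigma>" for \<sigma>
      using that sol unfolding solves_facet_problem_def L2_inner_facet_def
      by (intro local_problem_unique[OF fsS[OF S] sub \<psi> wS]) auto
    with sol show ?thesis by blast
  qed
  show thesis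
    by (rule that[of g h, OF cell cell_unique g(2)]) (simp_all add: facet_problem h(2))
qed

theorem theorem4p1:
  fixes \<Omega> :: "'a::euclidean_space set"
    and \<T> :: "'a set set"
    and \<iota> :: "'u::{real_inner,complete_space} \<Rightarrow> 'a \<Rightarrow> 'c::euclidean_space"
    and \<iota>' :: "'v::{real_inner,complete_space} \<Rightarrow> 'a \<Rightarrow> 'b::euclidean_space"
    and a :: "'u \<Rightarrow> 'v \<Rightarrow> real"
    and L :: "'v \<Rightarrow> real"
    and Vh :: "'u set" and Vh' :: "'v set" and uh :: 'u
    and D :: "'a set \<Rightarrow> ('a \<Rightarrow> 'b) set"
    and \<gamma> :: "'a set \<Rightarrow> ('a \<Rightarrow> 'b) \<Rightarrow> 'a \<Rightarrow> 'b"
    and rloc :: "'a set \<Rightarrow> ('a \<Rightarrow> 'b) \<Rightarrow> real"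
    and R Rb :: "'a set \<Rightarrow> 'a \<Rightarrow> 'b"
    and p q m n :: nat
    and \<phi> \<psi> :: "'a set \<Rightarrow> nat \<Rightarrow> 'a \<Rightarrow> real"
  assumes dim: "DIM('a) \<in> {1, 2, 3}"
    and domain: "polyhedral_domain \<Omega>"
    and mesh: "tessellation \<Omega> \<T>"
    and trial_space: "field_space \<Omega> \<iota>"
    and test_space: "field_space \<Omega> \<iota>'"
    and bilinear_form: "bounded_bilinear a"
    and linear_form: "bounded_linear L"
    and well_posed: "well_posed a"
    and discrete_trial_space: "fe_space \<T> \<iota> Vh"
    and discrete_test_space: "fe_space \<T> \<iota>' Vh'"
    and discrete_primal: "discrete_solution a L Vh Vh' uh"
    and discrete_unique: "\<And>w. discrete_solution a L Vh Vh' w \<Longrightarrow> w = uh"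
    and admissible: "\<And>T. T \<in> \<T> \<Longrightarrow> admissible_space T \<iota>' (D T)"
    and trace: "\<And>T. T \<in> \<T> \<Longrightarrow> trace_operator T (D T) (\<gamma> T)"
    and A1: "global_decomposition \<T> \<iota>' D (weak_residual a L uh) rloc"
    and A2: "\<And>T. T \<in> \<T> \<Longrightarrow> local_decomposition T (D T) (\<gamma> T) (rloc T) (R T) (Rb T)"
    and A3: "\<And>T. T \<in> \<T> \<Longrightarrow> polynomial_representation p q T (R T) (Rb T)"
    and cell_basis: "\<And>T. T \<in> \<T> \<Longrightarrow> poly_basis p T m (\<phi> T)"
    and facet_basis: "\<And>T. T \<in> \<T> \<Longrightarrow> poly_basis q T n (\<psi> T)"
    and bubble_admissible:
      "\<And>T i e. T \<in> \<T> \<Longrightarrow> i \<in> {1..m} \<Longrightarrow> e \<in> Basis \<Longrightarrow> bubble_field T (\<phi> T i) e \<in> D T"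
    and cone_admissible:
      "\<And>T S i e. T \<in> \<T> \<Longrightarrow> S facet_of T \<Longrightarrow> i \<in> {1..n} \<Longrightarrow> e \<in> Basis \<Longrightarrow>
         cone_field T S (\<psi> T i) e \<in> D T"
  shows "\<forall>T\<in>\<T>. \<forall>e\<in>Basis.
    (\<exists>!\<rho>. solves_cell_problem p T m (\<phi> T) (rloc T) e \<rho>) \<and>
    (\<forall>\<rho>. solves_cell_problem p T m (\<phi> T) (rloc T) e \<rho> \<longrightarrow>
       (AE x in lebesgue_on T. R T x \<bullet> e = \<rho> x) \<and>
       (\<forall>S. S facet_of T \<longrightarrow>
          (\<exists>!\<sigma>. solves_facet_problem q T S n (\<psi> T) (rloc T) e \<rho> \<sigma>) \<and>
          (\<forall>\<sigma>. solves_facet_problem q T S n (\<psi> T) (rloc T) e \<rho> \<sigma> \<longrightarrow>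
             (AE x in surface_measure S. Rb T x \<bullet> e = \<sigma> x))))"
proof (intro ballI)
  fix T e assume T: "T \<in> \<T>" and e: "e \<in> (Basis :: 'b set)"
  have simplex: "int DIM('a) simplex T" using mesh T by (simp add: tessellation_def)
  obtain g h where gh: "solves_cell_problem p T m (\<phi> T) (rloc T) e g"
    "\<And>\<rho>. solves_cell_problem p T m (\<phi> T) (rloc T) e \<rho> \<Longrightarrow> \<rho> = g"
    "AE x in lebesgue_on T. R T x \<bullet> e = g x"
    "\<And>S. S facet_of T \<Longrightarrow> solves_facet_problem q T S n (\<psi> T) (rloc T) e g (h S)"
    "\<And>S \<sigma>. S facet_of T \<Longrightarrow> solves_facet_problem q T S n (\<psi> T) (rloc T) e g \<sigma> \<Longrightarrow> \<sigma> = h S"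
    "\<And>S. S facet_of T \<Longrightarrow> AE x in surface_measure S. Rb T x \<bullet> e = h S x"
    by (rule simplex_local_problems[OF simplex trace[OF T] A2[OF T] A3[OF T] cell_basis[OF T]
        facet_basis[OF T] e bubble_admissible[OF T _ e] cone_admissible[OF T _ _ e]]) blast+
  \<comment> \<open>As \<open>g\<close> is the only cell solution, the facet problems have to be
    settled only with \<open>g\<close> as cell datum.\<close>
  have cell: "solves_cell_problem p T m (\<phi> T) (rloc T) e \<rho> \<longleftrightarrow> \<rho> = g" for \<rho>
    using gh(1,2) by blast
  have facet: "solves_facet_problem q T S n (\<psi> T) (rloc T) e g \<sigma> \<longleftrightarrow> \<sigma> = h S"
    if "S facet_of T" for S \<sigma>
    using gh(4,5)[OF that] by blast
  show "(\<exists>!\<rho>. solves_cell_problem p T m (\<phi> T) (rloc T) e \<rho>) \<and>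
    (\<forall>\<rho>. solves_cell_problem p T m (\<phi> T) (rloc T) e \<rho> \<longrightarrow>
       (AE x in lebesgue_on T. R T x \<bullet> e = \<rho> x) \<and>
       (\<forall>S. S facet_of T \<longrightarrow>
          (\<exists>!\<sigma>. solves_facet_problem q T S n (\<psi> T) (rloc T) e \<rho> \<sigma>) \<and>
          (\<forall>\<sigma>. solves_facet_problem q T S n (\<psi> T) (rloc T) e \<rho> \<sigma> \<longrightarrow>
             (AE x in surface_measure S. Rb T x \<bullet> e = \<sigma> x))))"
    using gh(3,6) by (simp add: cell facet)
qed

end
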